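(* Let $\alpha_1,\alpha_2,\alpha_3\in\mathbb{R}$ be the linearization coefficients of the car-following model and let $n\ge 1$ be an integer. If $$\alpha_1-\alpha_2\alpha_3+\alpha_3^2\neq 0,$$ then the "$1+n$" mixed platoon system $\dot X(t)=AX(t)+Bu(t)$, with one leading connected and automated vehicle and $n$ following human-driven vehicles, is controllable. This condition is the same for every platoon size $n$.
   Context: Model. Vehicle $0$ is the leading connected and automated vehicle (CAV), with position $x_0$, velocity $v_0$ and dynamics $\dot x_0=v_0$, $\dot v_0=u$, where $u(t)\in\mathbb{R}$ is the control input. Vehicles $i=1,\dots,n$ are human-driven vehicles with positions $x_i$, velocities $v_i$, headway distances $d_i=x_{i-1}-x_i$, and car-following dynamics $\dot v_i=F(d_i,\dot d_i,v_i)$. Let $(d^*,v^* )$ be an equilibrium, i.e. $F(d^*,0,v^* )=0$, and put $\tilde d_i=d_i-d^*$, $\tilde v_i=v_i-v^*$. The linearization coefficients are the real numbers $\alpha_1=\frac{\partial F}{\partial d}$, $\alpha_2=\frac{\partial F}{\partial \dot d}-\frac{\partial F}{\partial v}$, $\alpha_3=\frac{\partial F}{\partial \dot d}$, evaluated at the equilibrium. The state is $X=[x_0, v_0,\tilde d_1,\tilde v_1,\dots,\tilde d_n,\tilde v_n]^{\mathrm T}\in\mathbb{R}^{2n+2}$ and the mixed platoon system is $\dot X(t)=AX(t)+Bu(t)$, where $A\in\mathbb{R}^{(2n+2)\times(2n+2)}$ and $B\in\mathbb{R}^{(2n+2)\times 1}$ are defined in $2\times 2$ (respectively $2\times 1$)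 blocks, with block indices $0,1,\dots,n$, by: the $(0,0)$ block of $A$ is $C_1=\begin{bmatrix}0&1\\0&0\end{bmatrix}$; for $i=1,\dots,n$ the $(i,i)$ block of $A$ is $A_1=\begin{bmatrix}0&-1\\ \alpha_1&-\alpha_2\end{bmatrix}$ and the $(i,i-1)$ block of $A$ is $A_2=\begin{bmatrix}0&1\\0&\alpha_3\end{bmatrix}$; all other blocks of $A$ are zero; the $0$-th block of $B$ is $\begin{bmatrix}0\\1\end{bmatrix}$ and all other blocks of $B$ are zero. Controllability. The system $\dot x(t)=Ax(t)+Bu(t)$ (or the pair $(A,B)$) is controllable if for any initial state $x(0)=x_0$, any time $t_f>0$ and any final state $x_f$, there exists an input $u(t)$ such that $x(t_f)=x_f$.
   Formalization: The formal theorem adds the hypothesis α₁ ≠ 0; without it the claim fails for every n ≥ 1 (e.g. α₁ = α₂ = 0, α₃ = 1), because (α₂−α₃)x₀ − α₂d̃₁ + ṽ₁ is then conserved for every input. *)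

theory Defs
  imports Complex_Main "Jordan_Normal_Form.Matrix"
begin

text \<open>
  A car-following law is written \<open>F d d' v\<close> (headway, headway rate, velocity).  Only the partial
  derivatives at the equilibrium are needed.
\<close>

definition linearization_coefficients ::
    "(real \<Rightarrow> real \<Rightarrow> real \<Rightarrow> real) \<Rightarrow> real \<Rightarrow> real \<Rightarrow> real \<Rightarrow> real \<Rightarrow> real \<Rightarrow> bool" where
  "linearization_coefficients F d v \<alpha>\<^sub>1 \<alpha>\<^sub>2 \<alpha>\<^sub>3 \<longleftrightarrow>
     F d 0 v = 0 \<and>
     (\<exists>F\<^sub>d F\<^sub>r F\<^sub>v.
        ((\<lambda>y. F y 0 v) has_real_derivative F\<^sub>d) (at d) \<and>
        ((\<lambda>r. F d r v) has_real_derivative F\<^sub>r) (at 0) \<and>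
        ((\<lambda>w. F d 0 w) has_real_derivative F\<^sub>v) (at v) \<and>
        \<alpha>\<^sub>1 = F\<^sub>d \<and> \<alpha>\<^sub>2 = F\<^sub>r - F\<^sub>v \<and> \<alpha>\<^sub>3 = F\<^sub>r)"

text \<open>
  Every real triple occurs as a triple of linearization coefficients.
\<close>

lemma linearization_coefficients_exist:
  "linearization_coefficients
     (\<lambda>y r w. \<alpha>\<^sub>1 * (y - d) + \<alpha>\<^sub>3 * r + (\<alpha>\<^sub>3 - \<alpha>\<^sub>2) * (w - v)) d v \<alpha>\<^sub>1 \<alpha>\<^sub>2 \<alpha>\<^sub>3"
  unfolding linearization_coefficients_def
  by (intro conjI exI[of _ \<alpha>\<^sub>1] exI[of _ \<alpha>\<^sub>3] exI[of _ "\<alpha>\<^sub>3 - \<alpha>\<^sub>2"])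
     (auto intro!: derivative_eq_intros)

definition block_C1 :: "real mat" where
  "block_C1 = mat_of_rows_list 2 [[0, 1], [0, 0]]"

definition block_A1 :: "real \<Rightarrow> real \<Rightarrow> real mat" where
  "block_A1 \<alpha>\<^sub>1 \<alpha>\<^sub>2 = mat_of_rows_list 2 [[0, -1], [\<alpha>\<^sub>1, - \<alpha>\<^sub>2]]"

definition block_A2 :: "real \<Rightarrow> real mat" where
  "block_A2 \<alpha>\<^sub>3 = mat_of_rows_list 2 [[0, 1], [0, \<alpha>\<^sub>3]]"

definition platoon_block :: "real \<Rightarrow> real \<Rightarrow> real \<Rightarrow> nat \<Rightarrow> nat \<Rightarrow> real mat" where
  "platoon_block \<alpha>\<^sub>1 \<alpha>\<^sub>2 \<alpha>\<^sub>3 i j =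
     (if i = 0 \<and> j = 0 then block_C1
      else if i = j then block_A1 \<alpha>\<^sub>1 \<alpha>\<^sub>2
      else if i = j + 1 then block_A2 \<alpha>\<^sub>3
      else 0\<^sub>m 2 2)"

text \<open>
  Scalar coordinate \<open>k\<close> of the state lies in block \<open>k div 2\<close>, at position \<open>k mod 2\<close>.
\<close>

definition platoon_A :: "nat \<Rightarrow> real \<Rightarrow> real \<Rightarrow> real \<Rightarrow> real mat" where
  "platoon_A n \<alpha>\<^sub>1 \<alpha>\<^sub>2 \<alpha>\<^sub>3 =
     mat (2 * n + 2) (2 * n + 2)
       (\<lambda>(r, c). platoon_block \<alpha>\<^sub>1 \<alpha>\<^sub>2 \<alpha>\<^sub>3 (r div 2) (c div 2) $$ (r mod 2, c mod 2))"

definition platoon_B :: "nat \<Rightarrow> real mat" where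
  "platoon_B n = mat (2 * n + 2) 1 (\<lambda>(r, c). if r = 1 then 1 else 0)"

text \<open>
  Inputs are continuous and the state equation holds classically on \<open>[0, T]\<close>, with one-sided
  derivatives at the end points.  For such an input the trajectory is determined by \<open>x 0\<close>.
  Vectors and matrices with a run-time dimension carry no topology, so continuity and
  differentiability are stated coordinatewise.
\<close>

definition trajectory ::
    "real mat \<Rightarrow> real mat \<Rightarrow> real \<Rightarrow> (real \<Rightarrow> real vec) \<Rightarrow> (real \<Rightarrow> real vec) \<Rightarrow> bool" where
  "trajectory A B T u x \<longleftrightarrow>
     (\<forall>t\<in>{0..T}. u t \<in> carrier_vec (dim_col B)) \<and>
     (\<forall>j<dim_col B. continuous_on {0..T} (\<lambda>t. u t $ j)) \<and>
     (\<forall>t\<in>{0..T}. x t \<in> carrier_vec (dim_row A)) \<and>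
     (\<forall>t\<in>{0..T}. \<forall>i<dim_row A.
        ((\<lambda>s. x s $ i) has_real_derivative (A *\<^sub>v x t + B *\<^sub>v u t) $ i) (at t within {0..T}))"

definition controllable :: "real mat \<Rightarrow> real mat \<Rightarrow> bool" where
  "controllable A B \<longleftrightarrow>
     (\<forall>x0 \<in> carrier_vec (dim_row A). \<forall>xf \<in> carrier_vec (dim_row A). \<forall>T>0.
        \<exists>u x. trajectory A B T u x \<and> x 0 = x0 \<and> x T = xf)"

text \<open>
  If \<open>\<alpha>\<^sub>1 = 0\<close>, the quantity \<open>(\<alpha>\<^sub>2 - \<alpha>\<^sub>3) x\<^sub>0 - \<alpha>\<^sub>2 d\<^sub>1 + v\<^sub>1\<close> is conserved whatever the
  input, so the platoon is not controllable.  Hence \<open>\<alpha>\<^sub>1 - \<alpha>\<^sub>2 * \<alpha>\<^sub>3 + \<alpha>\<^sub>3\<^sup>2 \<noteq> 0\<close> does not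
  suffice for controllability without \<open>\<alpha>\<^sub>1 \<noteq> 0\<close>.
\<close>

lemma platoon_A_mult_first:
  fixes \<alpha>\<^sub>1 \<alpha>\<^sub>2 \<alpha>\<^sub>3 :: real
  assumes n: "n \<ge> 1" and y: "y \<in> carrier_vec (2 * n + 2)" and w: "w \<in> carrier_vec 1"
  defines "z \<equiv> platoon_A n \<alpha>\<^sub>1 \<alpha>\<^sub>2 \<alpha>\<^sub>3 *\<^sub>v y + platoon_B n *\<^sub>v w"
  shows "z $ 0 = y $ 1"
    and "z $ 2 = y $ 1 - y $ 3"
    and "z $ 3 = \<alpha>\<^sub>3 * y $ 1 + \<alpha>\<^sub>1 * y $ 2 - \<alpha>\<^sub>2 * y $ 3"
proof -
  have row: "z $ i = (\<Sum>j\<in>{0..<4}. platoon_A n \<alpha>\<^sub>1 \<alpha>\<^sub>2 \<alpha>\<^sub>3 $$ (i, j) * y $ j)"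
    if i: "i < 4" "i \<noteq> 1" for i
  proof -
    have "z $ i = (\<Sum>j\<in>{0..<2*n+2}. platoon_A n \<alpha>\<^sub>1 \<alpha>\<^sub>2 \<alpha>\<^sub>3 $$ (i, j) * y $ j)"
      using i n y w by (auto simp: z_def scalar_prod_def platoon_A_def platoon_B_def)
    also have "\<dots> = (\<Sum>j\<in>{0..<4}. platoon_A n \<alpha>\<^sub>1 \<alpha>\<^sub>2 \<alpha>\<^sub>3 $$ (i, j) * y $ j)"
    proof (rule sum.mono_neutral_right)
      show "\<forall>j\<in>{0..<2*n+2} - {0..<4}. platoon_A n \<alpha>\<^sub>1 \<alpha>\<^sub>2 \<alpha>\<^sub>3 $$ (i, j) * y $ j = 0"
      proof
        fix j assume j: "j \<in> {0..<2*n+2} - {0..<4}"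
        then have "j div 2 \<ge> 2" "i div 2 < 2" "i < 2*n+2" using i n by auto
        then show "platoon_A n \<alpha>\<^sub>1 \<alpha>\<^sub>2 \<alpha>\<^sub>3 $$ (i, j) * y $ j = 0"
          using j by (simp add: platoon_A_def platoon_block_def)
      qed
    qed (use n in auto)
    finally show ?thesis .
  qed
  have four: "{0..<4::nat} = {0, 1, 2, 3}" by auto
  have row4: "z $ i = (\<Sum>j\<in>{0, 1, 2, 3}. platoon_A n \<alpha>\<^sub>1 \<alpha>\<^sub>2 \<alpha>\<^sub>3 $$ (i, j) * y $ j)"
    if "i < 4" "i \<noteq> 1" for i
    using row[OF that] unfolding four .
  note entries = platoon_A_def platoon_block_def block_C1_def block_A1_def block_A2_def
    mat_of_rows_list_def
  show "z $ 0 = y $ 1"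
    by (subst row4) (use n in \<open>simp_all add: entries\<close>)
  show "z $ 2 = y $ 1 - y $ 3"
    by (subst row4) (use n in \<open>simp_all add: entries\<close>)
  show "z $ 3 = \<alpha>\<^sub>3 * y $ 1 + \<alpha>\<^sub>1 * y $ 2 - \<alpha>\<^sub>2 * y $ 3"
    by (subst row4) (use n in \<open>simp_all add: entries\<close>)
qed

lemma not_controllable_if_alpha1_zero:
  assumes n: "n \<ge> 1"
  shows "\<not> controllable (platoon_A n 0 \<alpha>\<^sub>2 \<alpha>\<^sub>3) (platoon_B n)"
proof
  let ?A = "platoon_A n 0 \<alpha>\<^sub>2 \<alpha>\<^sub>3" and ?B = "platoon_B n"
  have dims: "dim_row ?A = 2 * n + 2" "dim_col ?B = 1"
    by (auto simp: platoon_A_def platoon_B_def)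
  assume "controllable ?A ?B"
  then have "\<exists>u x. trajectory ?A ?B 1 u x \<and> x 0 = 0\<^sub>v (2*n+2) \<and> x 1 = unit_vec (2*n+2) 3"
    unfolding controllable_def dims
    by (elim ballE[where x = "0\<^sub>v (2*n+2)"] ballE[where x = "unit_vec (2*n+2) 3"]
          allE[where x = "1 :: real"] impE) simp_all
  then obtain u x where tr: "trajectory ?A ?B 1 u x"
    and x0: "x 0 = 0\<^sub>v (2*n+2)" and x1: "x 1 = unit_vec (2*n+2) 3"
    by (elim exE conjE)
  define q where "q s = (\<alpha>\<^sub>2 - \<alpha>\<^sub>3) * x s $ 0 - \<alpha>\<^sub>2 * x s $ 2 + x s $ 3" for s
  have q0: "(q has_real_derivative 0) (at t within {0..1})" if t: "t \<in> {0..1}" for t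
  proof -
    let ?z = "?A *\<^sub>v x t + ?B *\<^sub>v u t"
    have D: "((\<lambda>s. x s $ i) has_real_derivative ?z $ i) (at t within {0..1})"
      if "i < 2*n+2" for i
      using tr t that by (simp add: trajectory_def dims)
    have x: "x t \<in> carrier_vec (2*n+2)" and u: "u t \<in> carrier_vec 1"
      using tr t unfolding trajectory_def dims by simp_all
    have "(q has_real_derivative (\<alpha>\<^sub>2 - \<alpha>\<^sub>3) * ?z $ 0 - \<alpha>\<^sub>2 * ?z $ 2 + ?z $ 3)
        (at t within {0..1})"
      unfolding q_def using n by (intro derivative_intros D DERIV_cmult) auto
    then show ?thesis
      unfolding platoon_A_mult_first[OF n x u] by (simp add: algebra_simps)
  qed
  have "q 1 = q 0"
  proof (rule DERIV_isconst_end[of 0 1 q])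
    show "continuous_on {0..1} q"
      by (rule DERIV_continuous_on[of _ _ "\<lambda>_. 0"]) (rule q0)
    show "DERIV q t :> 0" if "0 < t" "t < 1" for t
      using q0[of t] that by (simp add: at_within_Icc_at)
  qed simp
  then show False using n by (simp add: q_def x0 x1)
qed

end

theory Submission
  imports
    Defs
    "Jordan_Normal_Form.Determinant"
    "HOL-Computational_Algebra.Field_as_Ring"
    "HOL-Computational_Algebra.Polynomial_Factorial"
begin

text \<open>
  The platoon has a flat output.  With \<open>s = d/dt\<close>, \<open>P = s\<^sup>2 + \<alpha>\<^sub>2 s + \<alpha>\<^sub>1\<close>, \<open>Q = \<alpha>\<^sub>3 s + \<alpha>\<^sub>1\<close> and
  \<open>R = s + \<alpha>\<^sub>2 - \<alpha>\<^sub>3\<close>, so that \<open>P = s R + Q\<close>, every polynomial \<open>y\<close> gives a solution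
  \<open>x\<^sub>0 = P\<^sup>n y\<close>, \<open>v\<^sub>0 = s P\<^sup>n y\<close>, \<open>d\<^sub>i = s P\<^bsup>n-i\<^esup> Q\<^bsup>i-1\<^esup> R y\<close>, \<open>v\<^sub>i = s P\<^bsup>n-i\<^esup> Q\<^sup>i y\<close> with input
  \<open>u = s\<^sup>2 P\<^sup>n y\<close>.  The \<open>2n + 2\<close> polynomials in \<open>s\<close> that produce the state have degree at most
  \<open>2n + 1\<close> and are linearly independent, because \<open>P\<close> is coprime to \<open>s\<close> and \<open>Q\<close>.  So prescribing
  the state at a time is the same as prescribing \<open>y, y', \<dots>, y\<^bsup>(2n+1)\<^esup>\<close> there, and Hermite
  interpolation at \<open>0\<close> and \<open>T\<close> provides such a \<open>y\<close>.
\<close>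

section \<open>Polynomials as differential operators\<close>

definition diff_op :: "real poly \<Rightarrow> real poly \<Rightarrow> real poly" where
  "diff_op p y = (\<Sum>j\<le>degree p. smult (coeff p j) ((pderiv ^^ j) y))"

text \<open>Zero padding to a common length \<open>m\<close> makes operators of different degrees
  comparable. At a fixed point, the value is then a row of \<open>m\<close> coefficients times the
  vector of derivatives of \<open>y\<close>.\<close>

lemma diff_op_eq_sum:
  assumes "degree p < m"
  shows "diff_op p y = (\<Sum>j<m. smult (coeff p j) ((pderiv ^^ j) y))"
  unfolding diff_op_def
  by (rule sum.mono_neutral_left) (use assms in \<open>auto simp: coeff_eq_0\<close>)

lemma diff_op_0 [simp]: "diff_op 0 y = 0"
  by (simp add: diff_op_def)

lemma diff_op_add: "diff_op (p + q) y = diff_op p y + diff_op q y"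
proof -
  define m where "m = Suc (max (degree p) (degree q))"
  have "degree p < m" "degree q < m" "degree (p + q) < m"
    using degree_add_le_max[of p q] by (auto simp: m_def)
  then show ?thesis
    by (simp add: diff_op_eq_sum[of _ m] smult_add_left sum.distrib)
qed

lemma smult_sum_right: "smult c (\<Sum>i\<in>I. f i) = (\<Sum>i\<in>I. smult c (f i))"
  by (induction I rule: infinite_finite_induct) (simp_all add: smult_add_right)

lemma diff_op_smult: "diff_op (smult c p) y = smult c (diff_op p y)"
proof -
  have "degree p < Suc (degree p)" "degree (smult c p) < Suc (degree p)"
    using degree_smult_le[of c p] by auto
  then show ?thesis
    by (simp add: diff_op_eq_sum[of _ "Suc (degree p)"] smult_sum_right del: sum.lessThan_Suc)
qed

lemma diff_op_sum: "diff_op (\<Sum>i\<in>I. f i) y = (\<Sum>i\<in>I. diff_op (f i) y)"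
  by (induction I rule: infinite_finite_induct) (simp_all add: diff_op_add)

text \<open>\<open>pCons 0\<close> is multiplication by s, so algebraic identities involving s
  become differential equations.\<close>

lemma diff_op_pCons_0: "diff_op (pCons 0 p) y = pderiv (diff_op p y)"
proof -
  define m where "m = Suc (degree p)"
  have m: "degree p < m" "degree (pCons 0 p) < Suc m"
    using degree_pCons_le[of 0 p] by (auto simp: m_def)
  show ?thesis
    unfolding diff_op_eq_sum[OF m(1)] diff_op_eq_sum[OF m(2)] sum.lessThan_Suc_shift
    by (simp add: higher_pderiv_sum[of 1, simplified] pderiv_smult)
qed

section \<open>Hermite interpolation\<close>

text \<open>Each derivative lowers the exponent of X - c by one and replaces the cofactor by one
  whose value at c is the old exponent times the previous value; these exponents multiply to
  m!.\<close>

lemma poly_higher_pderiv_linear_power_mult: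
  fixes c :: real
  assumes "k \<le> m"
  shows "poly ((pderiv ^^ k) ([:- c, 1:] ^ m * q)) c = (if k = m then fact m * poly q c else 0)"
  using assms
proof (induction k arbitrary: m q)
  case 0
  then show ?case by (cases m) auto
next
  case (Suc k)
  then obtain l where l: "m = Suc l" "k \<le> l" by (cases m) auto
  have d: "pderiv ([:- c, 1:] ^ Suc l * q)
      = [:- c, 1:] ^ l * (smult (of_nat (Suc l)) q + [:- c, 1:] * pderiv q)"
    unfolding pderiv_mult pderiv_power_Suc by (simp add: pderiv_pCons algebra_simps)
  have "poly ((pderiv ^^ Suc k) ([:- c, 1:] ^ m * q)) c
      = poly ((pderiv ^^ k) ([:- c, 1:] ^ l * (smult (of_nat (Suc l)) q + [:- c, 1:] * pderiv q))) c"
    unfolding l(1) funpow_Suc_right o_apply d ..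
  also have "\<dots> = (if k = l then fact (Suc l) * poly q c else 0)"
    unfolding Suc.IH[OF l(2)] by simp
  finally show ?case by (simp add: l(1))
qed

lemma hermite_interpolation_two_points:
  fixes a b :: "nat \<Rightarrow> real"
  assumes "T \<noteq> 0"
  shows "\<exists>y. \<forall>k<m. poly ((pderiv ^^ k) y) 0 = a k \<and> poly ((pderiv ^^ k) y) T = b k"
proof (induction m)
  case 0
  then show ?case by simp
next
  case (Suc m)
  then obtain y where y: "poly ((pderiv ^^ k) y) 0 = a k" "poly ((pderiv ^^ k) y) T = b k"
    if "k < m" for k
    by blast
  \<comment> \<open>The correction X^m (X - T)^m (e + f X) has no derivative of order below m at 0
    or T. Its m-th derivative is m! (-T)^m e at 0, which fixes \<open>e\<close>, and m! T^m (e + f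
    T) at T, which then fixes \<open>f\<close>.\<close>
  define e where "e = (a m - poly ((pderiv ^^ m) y) 0) / (fact m * (- T) ^ m)"
  define f where "f = ((b m - poly ((pderiv ^^ m) y) T) / (fact m * T ^ m) - e) / T"
  define z where "z = [:- 0, 1:] ^ m * ([:- T, 1:] ^ m * [:e, f:])"
  have z': "z = [:- T, 1:] ^ m * ([:- 0, 1:] ^ m * [:e, f:])"
    unfolding z_def by (rule mult.left_commute)
  have z0: "poly ((pderiv ^^ k) z) 0 = (if k = m then a m - poly ((pderiv ^^ m) y) 0 else 0)"
    if "k \<le> m" for k
    unfolding z_def poly_higher_pderiv_linear_power_mult[OF that]
    using assms by (simp add: e_def)
  have zT: "poly ((pderiv ^^ k) z) T = (if k = m then b m - poly ((pderiv ^^ m) y) T else 0)"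
    if "k \<le> m" for k
    unfolding z' poly_higher_pderiv_linear_power_mult[OF that]
    using assms by (simp add: f_def field_simps)
  have "poly ((pderiv ^^ k) (y + z)) 0 = a k \<and> poly ((pderiv ^^ k) (y + z)) T = b k"
    if "k < Suc m" for k
    using that y[of k] z0[of k] zT[of k] by (cases "k = m") (auto simp: higher_pderiv_add)
  then show ?case by blast
qed

section \<open>Controllability from a flat output\<close>

text \<open>The degree bound makes the coefficient matrix square, and a kernel vector of its
  transpose is a linear relation among the \<open>p i\<close>. The unknown \<eta> j stands for the
  j-th derivative of the flat output at an end point.\<close>

lemma solve_coefficient_system:
  fixes p :: "nat \<Rightarrow> real poly"
  assumes deg: "\<And>i. i < m \<Longrightarrow> degree (p i) < m"
    and indep: "\<And>c i. (\<Sum>i<m. smult (c i) (p i)) = 0 \<Longrightarrow> i < m \<Longrightarrow> c i = 0"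
  shows "\<exists>\<eta>. \<forall>i<m. (\<Sum>j<m. coeff (p i) j * \<eta> j) = x i"
proof -
  define M where "M = mat m m (\<lambda>(i, j). coeff (p i) j)"
  have M: "M \<in> carrier_mat m m" by (simp add: M_def)
  have "det (transpose_mat M) \<noteq> 0"
  proof
    assume "det (transpose_mat M) = 0"
    then obtain c where c: "c \<in> carrier_vec m" "c \<noteq> 0\<^sub>v m" "transpose_mat M *\<^sub>v c = 0\<^sub>v m"
      using det_0_iff_vec_prod_zero[of "transpose_mat M" m] M by auto
    have "(\<Sum>i<m. smult (c $ i) (p i)) = 0"
    proof (rule poly_eqI)
      fix j
      show "coeff (\<Sum>i<m. smult (c $ i) (p i)) j = coeff 0 j"
      proof (cases "j < m")
        case True
        then have "0 = (transpose_mat M *\<^sub>v c) $ j" by (simp add: c(3))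
        also have "\<dots> = (\<Sum>i<m. c $ i * coeff (p i) j)"
          using True c(1) by (simp add: M_def scalar_prod_def lessThan_atLeast0 mult.commute)
        finally show ?thesis by (simp add: coeff_sum)
      next
        case False
        then have "coeff (p i) j = 0" if "i < m" for i
          using deg[OF that] by (simp add: coeff_eq_0)
        then show ?thesis by (simp add: coeff_sum)
      qed
    qed
    then have "c $ i = 0" if "i < m" for i using indep that by blast
    then show False using c(1,2) by auto
  qed
  then have dM: "det M \<noteq> 0" using det_transpose[OF M] by simp
  \<comment> \<open>The inverse of \<open>M\<close>, written as adjugate over determinant, applied
    to the right-hand side.\<close>
  define h where "h = (1 / det M) \<cdot>\<^sub>v (adj_mat M *\<^sub>v vec m x)"
  have h: "h \<in> carrier_vec m" using adj_mat(1)[OF M] by (simp add: h_def)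
  have "M *\<^sub>v h = (1 / det M) \<cdot>\<^sub>v (M *\<^sub>v (adj_mat M *\<^sub>v vec m x))"
    unfolding h_def using M adj_mat(1)[OF M] by (intro mult_mat_vec) auto
  also have "M *\<^sub>v (adj_mat M *\<^sub>v vec m x) = (M * adj_mat M) *\<^sub>v vec m x"
    using M adj_mat(1)[OF M] by (intro assoc_mult_mat_vec[symmetric]) auto
  also have "\<dots> = det M \<cdot>\<^sub>v vec m x"
    unfolding adj_mat(2)[OF M] by (intro eq_vecI) auto
  finally have Mh: "M *\<^sub>v h = vec m x" using dM by auto
  have "(\<Sum>j<m. coeff (p i) j * h $ j) = x i" if "i < m" for i
  proof -
    have "(\<Sum>j<m. coeff (p i) j * h $ j) = (M *\<^sub>v h) $ i"
      using that h by (simp add: M_def scalar_prod_def lessThan_atLeast0)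
    then show ?thesis using that Mh by simp
  qed
  then show ?thesis by blast
qed

text \<open>\<open>dyn\<close> is the state equation with s in place of d/dt: \<open>p i\<close>
  generates coordinate \<open>i\<close> and \<open>q\<close> the input. Every polynomial
  \<open>y\<close> therefore yields a trajectory, and only the end points remain to be
  matched.\<close>

lemma controllable_if_flat:
  fixes p :: "nat \<Rightarrow> real poly"
  assumes A: "A \<in> carrier_mat m m" and B: "B \<in> carrier_mat m 1"
    and deg: "\<And>i. i < m \<Longrightarrow> degree (p i) < m"
    and indep: "\<And>c i. (\<Sum>i<m. smult (c i) (p i)) = 0 \<Longrightarrow> i < m \<Longrightarrow> c i = 0"
    and dyn: "\<And>i. i < m \<Longrightarrow> pCons 0 (p i) = (\<Sum>j<m. smult (A $$ (i, j)) (p j)) + smult (B $$ (i, 0)) q"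
  shows "controllable A B"
  unfolding controllable_def
proof (intro ballI allI impI)
  fix x0 xf :: "real vec" and T :: real
  assume "x0 \<in> carrier_vec (dim_row A)" "xf \<in> carrier_vec (dim_row A)" and T: "T > 0"
  then have x0: "x0 \<in> carrier_vec m" and xf: "xf \<in> carrier_vec m" using A by auto
  \<comment> \<open>\<open>a j\<close> and \<open>b j\<close> are the values that the j-th
    derivative of \<open>y\<close> must take at 0 and at \<open>T\<close>.\<close>
  obtain a where a: "(\<Sum>j<m. coeff (p i) j * a j) = x0 $ i" if "i < m" for i
    using solve_coefficient_system[of m p "\<lambda>i. x0 $ i"] deg indep by blast
  obtain b where b: "(\<Sum>j<m. coeff (p i) j * b j) = xf $ i" if "i < m" for i
    using solve_coefficient_system[of m p "\<lambda>i. xf $ i"] deg indep by blast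
  obtain y where y: "poly ((pderiv ^^ k) y) 0 = a k" "poly ((pderiv ^^ k) y) T = b k"
    if "k < m" for k
    using hermite_interpolation_two_points[of T m a b] T by blast
  define x where "x t = vec m (\<lambda>i. poly (diff_op (p i) y) t)" for t
  define u where "u t = vec 1 (\<lambda>_. poly (diff_op q y) t)" for t
  have "((\<lambda>s. x s $ i) has_real_derivative (A *\<^sub>v x t + B *\<^sub>v u t) $ i) (at t within {0..T})"
    if i: "i < m" for i t
  proof -
    have "(A *\<^sub>v x t + B *\<^sub>v u t) $ i
        = (\<Sum>j<m. A $$ (i, j) * poly (diff_op (p j) y) t) + B $$ (i, 0) * poly (diff_op q y) t"
      using A B i by (simp add: x_def u_def scalar_prod_def lessThan_atLeast0)
    also have "\<dots> = poly (diff_op (pCons 0 (p i)) y) t"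
      unfolding dyn[OF i] by (simp add: diff_op_add diff_op_sum diff_op_smult poly_sum)
    finally show ?thesis
      using i by (simp add: x_def diff_op_pCons_0 poly_DERIV has_field_derivative_at_within)
  qed
  then have "trajectory A B T u x"
    using A B by (auto simp: trajectory_def x_def u_def intro!: continuous_intros)
  moreover have "x 0 = x0"
    using x0 a y(1) by (intro eq_vecI) (auto simp: x_def diff_op_eq_sum[OF deg] poly_sum)
  moreover have "x T = xf"
    using xf b y(2) by (intro eq_vecI) (auto simp: x_def diff_op_eq_sum[OF deg] poly_sum)
  ultimately show "\<exists>u x. trajectory A B T u x \<and> x 0 = x0 \<and> x T = xf" by blast
qed

section \<open>The platoon\<close>

lemma dvd_imp_eq_0_if_degree_less:
  fixes p q :: "real poly"
  assumes "p dvd q" "degree q < degree p"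
  shows "q = 0"
  using dvd_imp_degree_le[OF assms(1)] assms(2) by auto

lemma sum_pairs: "(\<Sum>k<2 * n + 2. f k) = (\<Sum>i\<le>n. f (2 * i) + f (2 * i + 1))"
  for f :: "nat \<Rightarrow> 'a::comm_monoid_add"
  by (induction n) (simp_all add: add.assoc)

lemma degree_power_mult_power_le:
  fixes p q :: "real poly"
  assumes "degree p \<le> 2" "degree q \<le> 1" "i \<le> n"
  shows "degree (p ^ (n - i) * q ^ i) \<le> 2 * n - i"
proof -
  have "degree (p ^ (n - i)) \<le> 2 * (n - i)"
    using degree_power_le[of p "n - i"] mult_le_mono1[OF assms(1), of "n - i"] by linarith
  moreover have "degree (q ^ i) \<le> i"
    using degree_power_le[of q i] mult_le_mono1[OF assms(2), of i] by linarith
  ultimately show ?thesis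
    using degree_mult_le[of "p ^ (n - i)" "q ^ i"] assms(3) by linarith
qed

context
  fixes \<alpha>\<^sub>1 \<alpha>\<^sub>2 \<alpha>\<^sub>3 :: real
begin

definition char_poly_P :: "real poly" where "char_poly_P = [:\<alpha>\<^sub>1, \<alpha>\<^sub>2, 1:]"

definition velocity_poly_Q :: "real poly" where "velocity_poly_Q = [:\<alpha>\<^sub>1, \<alpha>\<^sub>3:]"

definition headway_poly_R :: "real poly" where "headway_poly_R = [:\<alpha>\<^sub>2 - \<alpha>\<^sub>3, 1:]"

text \<open>Index 0 is the absolute position of the leader, the only coordinate without a factor s;
  the other indices are headways.\<close>

definition pos_poly :: "nat \<Rightarrow> nat \<Rightarrow> real poly" where
  "pos_poly n i = (if i = 0 then char_poly_P ^ n
     else pCons 0 (char_poly_P ^ (n - i) * velocity_poly_Q ^ (i - 1) * headway_poly_R))"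

definition vel_poly :: "nat \<Rightarrow> nat \<Rightarrow> real poly" where
  "vel_poly n i = pCons 0 (char_poly_P ^ (n - i) * velocity_poly_Q ^ i)"

definition state_poly :: "nat \<Rightarrow> nat \<Rightarrow> real poly" where
  "state_poly n k = (if even k then pos_poly n (k div 2) else vel_poly n (k div 2))"

lemma state_poly_simps [simp]:
  "state_poly n (2 * i) = pos_poly n i" "state_poly n (Suc (2 * i)) = vel_poly n i"
  by (simp_all add: state_poly_def)

lemma degree_state_poly:
  assumes "k < 2 * n + 2"
  shows "degree (state_poly n k) < 2 * n + 2"
proof -
  have P: "degree char_poly_P \<le> 2" and Q: "degree velocity_poly_Q \<le> 1"
    and R: "degree headway_poly_R \<le> 1"
    by (simp_all add: char_poly_P_def velocity_poly_Q_def headway_poly_R_def)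
  define i where "i = k div 2"
  have i: "i \<le> n" using assms by (simp add: i_def)
  have "degree (vel_poly n i) \<le> Suc (2 * n - i)"
    using degree_pCons_le degree_power_mult_power_le[OF P Q i] unfolding vel_poly_def
    by (meson Suc_le_mono le_trans)
  moreover have "degree (pos_poly n i) \<le> 2 * n + 1"
  proof (cases i)
    case 0
    then show ?thesis
      using degree_power_mult_power_le[OF P Q, of 0 n] by (simp add: pos_poly_def)
  next
    case (Suc l)
    \<comment> \<open>Here n - i = (n - 1) - l, so the bound is taken for n - 1.\<close>
    then have "degree (char_poly_P ^ (n - i) * velocity_poly_Q ^ l) \<le> 2 * (n - 1) - l"
      using degree_power_mult_power_le[OF P Q, of l "n - 1"] i by simp
    then have "degree (char_poly_P ^ (n - i) * velocity_poly_Q ^ l * headway_poly_R) \<le> 2 * n"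
      using degree_mult_le[of "char_poly_P ^ (n - i) * velocity_poly_Q ^ l" headway_poly_R] R i Suc
      by linarith
    then show ?thesis
      using Suc degree_pCons_le[of 0 "char_poly_P ^ (n - i) * velocity_poly_Q ^ l * headway_poly_R"]
      by (simp add: pos_poly_def)
  qed
  ultimately show ?thesis by (auto simp: state_poly_def i_def)
qed

text \<open>For a follower, both rows reduce to identities among P, Q, R: s R = P - Q for the
  headway, and \<open>s Q = \<alpha>\<^sub>1 R + \<alpha>\<^sub>3 P - \<alpha>\<^sub>2 Q\<close> for
  the velocity. The input polynomial is s^2 P^n.\<close>

lemma state_poly_dynamics:
  assumes k: "k < 2 * n + 2"
  shows "pCons 0 (state_poly n k)
    = (\<Sum>j<2 * n + 2. smult (platoon_A n \<alpha>\<^sub>1 \<alpha>\<^sub>2 \<alpha>\<^sub>3 $$ (k, j)) (state_poly n j))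
      + smult (platoon_B n $$ (k, 0)) (pCons 0 (vel_poly n 0))"
proof -
  define i where "i = k div 2"
  have i: "i \<le> n" using k by (simp add: i_def)
  define E where "E b = (platoon_block \<alpha>\<^sub>1 \<alpha>\<^sub>2 \<alpha>\<^sub>3 i b)" for b
  define S where "S b = smult (E b $$ (k mod 2, 0)) (pos_poly n b)
    + smult (E b $$ (k mod 2, 1)) (vel_poly n b)" for b
  have "(\<Sum>j<2 * n + 2. smult (platoon_A n \<alpha>\<^sub>1 \<alpha>\<^sub>2 \<alpha>\<^sub>3 $$ (k, j)) (state_poly n j)) = (\<Sum>b\<le>n. S b)"
    unfolding sum_pairs using k
    by (intro sum.cong) (auto simp: platoon_A_def S_def E_def i_def)
  \<comment> \<open>Block row \<open>i\<close> meets only blocks \<open>i - 1\<close> and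
    \<open>i\<close>; for \<open>i = 0\<close> truncated subtraction collapses the set to
    \<open>{0}\<close>.\<close>
  also have "\<dots> = (\<Sum>b\<in>{i - 1, i}. S b)"
    by (rule sum.mono_neutral_right)
       (use i in \<open>auto simp: S_def E_def platoon_block_def\<close>)
  finally have sum: "(\<Sum>j<2 * n + 2. smult (platoon_A n \<alpha>\<^sub>1 \<alpha>\<^sub>2 \<alpha>\<^sub>3 $$ (k, j)) (state_poly n j))
      = (\<Sum>b\<in>{i - 1, i}. S b)" .
  note entries = S_def E_def platoon_block_def block_C1_def block_A1_def block_A2_def
    mat_of_rows_list_def
  show ?thesis
  proof (cases i)
    case 0
    then have "k = 0 \<or> k = 1" by (auto simp: i_def)
    then show ?thesis
      unfolding sum using 0
      by (auto simp: entries platoon_B_def state_poly_def pos_poly_def vel_poly_def)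
  next
    case (Suc l)
    define W where "W = char_poly_P ^ (n - i) * velocity_poly_Q ^ l"
    have "n - l = Suc (n - i)" using Suc i by simp
    then have polys: "pos_poly n i = pCons 0 (W * headway_poly_R)"
      "vel_poly n i = pCons 0 (W * velocity_poly_Q)"
      "vel_poly n l = pCons 0 (W * char_poly_P)"
      using Suc by (simp_all add: pos_poly_def vel_poly_def W_def mult_ac)
    have ring: "pCons 0 headway_poly_R = char_poly_P - velocity_poly_Q"
      "pCons 0 velocity_poly_Q = smult \<alpha>\<^sub>1 headway_poly_R
         + (smult \<alpha>\<^sub>3 char_poly_P - smult \<alpha>\<^sub>2 velocity_poly_Q)"
      by (simp_all add: headway_poly_R_def char_poly_P_def velocity_poly_Q_def algebra_simps)
    have "pCons 0 (pos_poly n i) = pCons 0 (W * pCons 0 headway_poly_R)"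
      by (simp add: polys)
    then have pos: "pCons 0 (pos_poly n i) = vel_poly n l - vel_poly n i"
      by (simp only: polys ring(1) right_diff_distrib diff_pCons) simp
    have "pCons 0 (W * velocity_poly_Q) = W * pCons 0 velocity_poly_Q"
      by simp
    also have "\<dots> = smult \<alpha>\<^sub>1 (W * headway_poly_R)
        + (smult \<alpha>\<^sub>3 (W * char_poly_P) - smult \<alpha>\<^sub>2 (W * velocity_poly_Q))"
      unfolding ring(2) by (simp only: right_diff_distrib distrib_left mult_smult_right)
    finally have "pCons 0 (vel_poly n i) = pCons 0 (smult \<alpha>\<^sub>1 (W * headway_poly_R)
        + (smult \<alpha>\<^sub>3 (W * char_poly_P) - smult \<alpha>\<^sub>2 (W * velocity_poly_Q)))"
      unfolding polys(2) by (rule arg_cong)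
    then have vel: "pCons 0 (vel_poly n i)
        = smult \<alpha>\<^sub>1 (pos_poly n i) + (smult \<alpha>\<^sub>3 (vel_poly n l) - smult \<alpha>\<^sub>2 (vel_poly n i))"
      by (rule trans) (simp add: polys)
    have l: "i - 1 = l" "l \<noteq> i" "i \<noteq> 0" using Suc by auto
    have B: "platoon_B n $$ (k, 0) = 0"
      using k l(3) by (auto simp: platoon_B_def i_def)
    show ?thesis
    proof (cases "even k")
      case True
      then have "state_poly n k = pos_poly n i" "k mod 2 = 0"
        by (auto simp: state_poly_def i_def)
      moreover have "(\<Sum>b\<in>{l, i}. S b) = vel_poly n l - vel_poly n i"
        using l \<open>k mod 2 = 0\<close> by (simp add: entries)
      ultimately show ?thesis
        unfolding sum B l(1) using pos by simp
    next
      case False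
      then have "state_poly n k = vel_poly n i" "k mod 2 = 1"
        by (auto simp: state_poly_def i_def odd_iff_mod_2_eq_one)
      moreover have "(\<Sum>b\<in>{l, i}. S b)
          = smult \<alpha>\<^sub>1 (pos_poly n i) + (smult \<alpha>\<^sub>3 (vel_poly n l) - smult \<alpha>\<^sub>2 (vel_poly n i))"
        using l \<open>k mod 2 = 1\<close> by (simp add: entries)
      ultimately show ?thesis
        unfolding sum B l(1) by (simp only: vel smult_0_left add_0_right)
    qed
  qed
qed

text \<open>P is coprime to s Q^n, so it divides a R + b Q, whose degree is below 2; this
  combination is therefore 0. R and Q are independent because their coefficient determinant is, up
  to sign, \<open>\<alpha>\<^sub>1 - \<alpha>\<^sub>2 * \<alpha>\<^sub>3 +
  \<alpha>\<^sub>3\<^sup>2\<close>.\<close>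

lemma state_poly_independent_step:
  assumes "\<alpha>\<^sub>1 \<noteq> 0" and "\<alpha>\<^sub>1 - \<alpha>\<^sub>2 * \<alpha>\<^sub>3 + \<alpha>\<^sub>3\<^sup>2 \<noteq> 0"
    and "char_poly_P * f + pCons 0 (velocity_poly_Q ^ n
      * (smult a headway_poly_R + smult b velocity_poly_Q)) = 0"
  shows "f = 0" "a = 0" "b = 0"
proof -
  let ?L = "smult a headway_poly_R + smult b velocity_poly_Q"
  have L: "?L = [:a * (\<alpha>\<^sub>2 - \<alpha>\<^sub>3) + b * \<alpha>\<^sub>1, a + b * \<alpha>\<^sub>3:]"
    by (simp add: headway_poly_R_def velocity_poly_Q_def)
  have "coprime char_poly_P velocity_poly_Q"
  proof (rule coprimeI)
    fix d assume d: "d dvd char_poly_P" "d dvd velocity_poly_Q"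
    \<comment> \<open>A Bezout identity: the constant is the resultant of P and Q, nonzero by both
      hypotheses.\<close>
    have "[:\<alpha>\<^sub>1 * (\<alpha>\<^sub>1 - \<alpha>\<^sub>2 * \<alpha>\<^sub>3 + \<alpha>\<^sub>3\<^sup>2):]
        = [:\<alpha>\<^sub>3\<^sup>2:] * char_poly_P - [:\<alpha>\<^sub>2 * \<alpha>\<^sub>3 - \<alpha>\<^sub>1, \<alpha>\<^sub>3:] * velocity_poly_Q"
      by (simp add: char_poly_P_def velocity_poly_Q_def algebra_simps power2_eq_square)
    moreover have "d dvd \<dots>" using d by (intro dvd_diff dvd_mult)
    ultimately have "d dvd [:\<alpha>\<^sub>1 * (\<alpha>\<^sub>1 - \<alpha>\<^sub>2 * \<alpha>\<^sub>3 + \<alpha>\<^sub>3\<^sup>2):]" by simp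
    moreover have "is_unit [:\<alpha>\<^sub>1 * (\<alpha>\<^sub>1 - \<alpha>\<^sub>2 * \<alpha>\<^sub>3 + \<alpha>\<^sub>3\<^sup>2):]"
      using assms(1,2) by (simp add: is_unit_const_poly_iff dvd_field_iff)
    ultimately show "is_unit d" by (rule dvd_unit_imp_unit)
  qed
  moreover have "coprime char_poly_P [:0, 1:]"
  proof (rule coprimeI)
    fix d assume d: "d dvd char_poly_P" "d dvd [:0, 1:]"
    have "[:\<alpha>\<^sub>1:] = char_poly_P - [:\<alpha>\<^sub>2, 1:] * [:0, 1:]"
      by (simp add: char_poly_P_def)
    moreover have "d dvd \<dots>" using d by (intro dvd_diff dvd_mult)
    ultimately have "d dvd [:\<alpha>\<^sub>1:]" by simp
    moreover have "is_unit [:\<alpha>\<^sub>1:]" using assms(1) by (simp add: is_unit_const_poly_iff dvd_field_iff)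
    ultimately show "is_unit d" by (rule dvd_unit_imp_unit)
  qed
  ultimately have cop: "coprime char_poly_P ([:0, 1:] * velocity_poly_Q ^ n)"
    unfolding coprime_mult_right_iff coprime_power_right_iff by blast
  have eq: "char_poly_P * f + ([:0, 1:] * velocity_poly_Q ^ n) * ?L = 0"
    using assms(3) by simp
  then have "([:0, 1:] * velocity_poly_Q ^ n) * ?L = char_poly_P * (- f)"
    by (simp add: eq_neg_iff_add_eq_0 add.commute)
  then have "char_poly_P dvd ([:0, 1:] * velocity_poly_Q ^ n) * ?L" by (metis dvd_triv_left)
  then have "char_poly_P dvd ?L" using cop coprime_dvd_mult_right_iff by blast
  moreover have "degree ?L < degree char_poly_P" unfolding L by (simp add: char_poly_P_def)
  ultimately have L0: "?L = 0" by (rule dvd_imp_eq_0_if_degree_less)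
  then have ab: "a * (\<alpha>\<^sub>2 - \<alpha>\<^sub>3) + b * \<alpha>\<^sub>1 = 0" "a + b * \<alpha>\<^sub>3 = 0" unfolding L by auto
  have "b * (\<alpha>\<^sub>1 - \<alpha>\<^sub>2 * \<alpha>\<^sub>3 + \<alpha>\<^sub>3\<^sup>2)
      = (a * (\<alpha>\<^sub>2 - \<alpha>\<^sub>3) + b * \<alpha>\<^sub>1) - (\<alpha>\<^sub>2 - \<alpha>\<^sub>3) * (a + b * \<alpha>\<^sub>3)"
    by (simp add: algebra_simps power2_eq_square)
  then have "b * (\<alpha>\<^sub>1 - \<alpha>\<^sub>2 * \<alpha>\<^sub>3 + \<alpha>\<^sub>3\<^sup>2) = 0" by (simp add: ab)
  with assms(2) show "b = 0" by simp
  with ab show "a = 0" by simp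
  have "char_poly_P \<noteq> 0" by (simp add: char_poly_P_def)
  then show "f = 0" using eq L0 by simp
qed

text \<open>Passing from \<open>n\<close> to \<open>Suc n\<close> multiplies all old state
  polynomials by P; only the two of the new last vehicle lack this factor, and the previous lemma
  separates them.\<close>

lemma state_poly_independent:
  assumes \<alpha>: "\<alpha>\<^sub>1 \<noteq> 0" "\<alpha>\<^sub>1 - \<alpha>\<^sub>2 * \<alpha>\<^sub>3 + \<alpha>\<^sub>3\<^sup>2 \<noteq> 0"
    and "(\<Sum>k<2 * n + 2. smult (c k) (state_poly n k)) = 0" and "k < 2 * n + 2"
  shows "c k = 0"
  using assms(3,4)
proof (induction n arbitrary: k)
  case 0
  then show ?case
    by (auto simp: state_poly_def pos_poly_def vel_poly_def less_Suc_eq)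
next
  case (Suc n)
  let ?f = "\<lambda>n. \<Sum>i\<le>n. smult (c (2 * i)) (pos_poly n i) + smult (c (Suc (2 * i))) (vel_poly n i)"
  have f: "(\<Sum>k<2 * n + 2. smult (c k) (state_poly n k)) = ?f n" for n
    unfolding sum_pairs by simp
  have "pos_poly (Suc n) i = char_poly_P * pos_poly n i"
    "vel_poly (Suc n) i = char_poly_P * vel_poly n i"
    if "i \<le> n" for i
    using that by (auto simp: pos_poly_def vel_poly_def Suc_diff_le)
  then have "(\<Sum>i\<le>n. smult (c (2 * i)) (pos_poly (Suc n) i) + smult (c (Suc (2 * i))) (vel_poly (Suc n) i))
      = char_poly_P * ?f n"
    by (simp add: sum_distrib_left distrib_left)
  moreover have "smult a (pos_poly (Suc n) (Suc n)) + smult b (vel_poly (Suc n) (Suc n))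
      = pCons 0 (velocity_poly_Q ^ n * (smult a headway_poly_R + smult b velocity_poly_Q))" for a b
    by (simp add: pos_poly_def vel_poly_def algebra_simps)
  ultimately have "char_poly_P * ?f n + pCons 0 (velocity_poly_Q ^ n
      * (smult (c (2 * Suc n)) headway_poly_R + smult (c (Suc (2 * Suc n))) velocity_poly_Q)) = 0"
    using Suc.prems(1) unfolding f by (simp only: sum.atMost_Suc)
  note step = state_poly_independent_step[OF \<alpha> this]
  have "c k = 0" if "k < 2 * n + 2"
    using Suc.IH that step(1) unfolding f by blast
  moreover have "k < 2 * n + 2 \<or> k = 2 * Suc n \<or> k = Suc (2 * Suc n)"
    using Suc.prems(2) by auto
  ultimately show ?case using step(2,3) by blast
qed

lemma platoon_controllable:
  assumes "\<alpha>\<^sub>1 \<noteq> 0" "\<alpha>\<^sub>1 - \<alpha>\<^sub>2 * \<alpha>\<^sub>3 + \<alpha>\<^sub>3\<^sup>2 \<noteq> 0"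
  shows "controllable (platoon_A n \<alpha>\<^sub>1 \<alpha>\<^sub>2 \<alpha>\<^sub>3) (platoon_B n)"
proof (rule controllable_if_flat)
  show "platoon_A n \<alpha>\<^sub>1 \<alpha>\<^sub>2 \<alpha>\<^sub>3 \<in> carrier_mat (2 * n + 2) (2 * n + 2)"
    by (simp add: platoon_A_def)
  show "platoon_B n \<in> carrier_mat (2 * n + 2) 1"
    by (simp add: platoon_B_def)
  show "c k = 0" if "(\<Sum>k<2 * n + 2. smult (c k) (state_poly n k)) = 0" "k < 2 * n + 2" for c k
    using state_poly_independent[OF assms that] .
qed (use degree_state_poly state_poly_dynamics in blast)+

end

text \<open>The hypothesis \<open>\<alpha>\<^sub>1 \<noteq> 0\<close> cannot be dropped, by
  \<open>not_controllable_if_alpha1_zero\<close>; for \<open>\<alpha>\<^sub>1 = 0\<close>, s is a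
  common factor of P and Q.\<close>

theorem theorem2:
  fixes F :: "real \<Rightarrow> real \<Rightarrow> real \<Rightarrow> real"
    and d_star v_star \<alpha>\<^sub>1 \<alpha>\<^sub>2 \<alpha>\<^sub>3 :: real
  assumes "linearization_coefficients F d_star v_star \<alpha>\<^sub>1 \<alpha>\<^sub>2 \<alpha>\<^sub>3"
    and "\<alpha>\<^sub>1 \<noteq> 0"
    and "\<alpha>\<^sub>1 - \<alpha>\<^sub>2 * \<alpha>\<^sub>3 + \<alpha>\<^sub>3\<^sup>2 \<noteq> 0"
  shows "\<forall>n\<ge>1. controllable (platoon_A n \<alpha>\<^sub>1 \<alpha>\<^sub>2 \<alpha>\<^sub>3) (platoon_B n)"
  using platoon_controllable assms by blast

end
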